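(* Let $\mathcal{A}$ be a finite poset with connected Hasse diagram. If $\mathcal{A}$ is not synchronizable for Class $\mathrm{W}_\star$, then there is some $n\ge 1$ such that monotonicity equivalence fails for $(\mathcal{A},\mathcal{S})$, where $\mathcal{S}$ is the $(n+2)$-legged $\mathrm{W}_\star$-poset.
   Context: The $(n+2)$-legged $\mathrm{W}_\star$-poset is the poset on $\{z,y_0,y_1,\ldots,y_n,y_*\}$ whose only strict relations are $y<z$ for each $y\in\{y_0,y_1,\ldots,y_n,y_*\}$. The Hasse diagram of a poset is regarded as an undirected graph. Synchronizability. Let $D_{\mathcal{A}}$ be the set of minimal elements of $\mathcal{A}$, and let $G_{\mathcal{A}}=(D_{\mathcal{A}},E_{\mathcal{A}})$ be the graph in which distinct $\beta,\beta'\in D_{\mathcal{A}}$ are joined by an edge iff there is $\alpha\in\mathcal{A}$ with $\beta,\beta'<\alpha$. For $\alpha\in\mathcal{A}$ put $D_{\mathcal{A}}(\alpha)=\{\beta\in D_{\mathcal{A}}:\beta\le\alpha\}$. A spanning tree $T$ of $G_{\mathcal{A}}$ is locally connected if for every $\alpha\in\mathcal{A}$ the subgraph of $T$ induced on $D_{\mathcal{A}}(\alpha)$ is connected. $\mathcal{A}$ is synchronizable for Class $\mathrm{W}_\star$ if $G_{\mathcal{A}}$ has a locally connected spanning tree. Monotonicity. For probability measures $P,P'$ on $\mathcal{S}$, $P\preceq P'$ means $P(U)\le P'(U)$ for every up-set $U$ of $\mathcal{S}$. A system $(P_\gamma:\gamma\in\mathcal{A})$ of probability measures on $\mathcal{S}$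 is stochastically monotone if $P_\alpha\preceq P_\beta$ whenever $\alpha<\beta$ in $\mathcal{A}$. It is realizably monotone if there are $\mathcal{S}$-valued random variables $(X_\gamma:\gamma\in\mathcal{A})$ on a common probability space such that $X_\gamma$ has distribution $P_\gamma$ for each $\gamma$ and $X_\alpha\le X_\beta$ in $\mathcal{S}$ whenever $\alpha<\beta$ in $\mathcal{A}$. Monotonicity equivalence holds for $(\mathcal{A},\mathcal{S})$ if, for systems of probability measures on $\mathcal{S}$ indexed by $\mathcal{A}$, stochastic monotonicity and realizable monotonicity are equivalent; it fails if some stochastically monotone system is not realizably monotone. *)

theory Defs
  imports "HOL-Probability.Probability"
begin

text \<open>
  A poset is a carrier set with a reflexive order relation (\<^const>\<open>partial_order_on\<close>); the strict
  relation \<open>x < y\<close> is \<open>(x, y) \<in> r - Id\<close>. A simple undirected graph is a vertex set together with a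
  set of two-element edges.
\<close>

section \<open>Graphs\<close>

definition adj :: "'a set set \<Rightarrow> 'a rel" where
  "adj E = {(u, v). {u, v} \<in> E}"

definition graph_connected :: "'a set \<Rightarrow> 'a set set \<Rightarrow> bool" where
  "graph_connected V E \<longleftrightarrow> V \<noteq> {} \<and> (\<forall>u\<in>V. \<forall>v\<in>V. (u, v) \<in> (adj E)\<^sup>*)"

definition induced_edges :: "'a set set \<Rightarrow> 'a set \<Rightarrow> 'a set set" where
  "induced_edges E W = {e \<in> E. e \<subseteq> W}"

definition graph_cycle :: "'a set set \<Rightarrow> 'a list \<Rightarrow> bool" where
  "graph_cycle E c \<longleftrightarrow> 3 \<le> length c \<and> distinct c \<and>
     (\<forall>i<length c. {c ! i, c ! (Suc i mod length c)} \<in> E)"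

definition spanning_tree :: "'a set \<Rightarrow> 'a set set \<Rightarrow> 'a set set \<Rightarrow> bool" where
  "spanning_tree V E T \<longleftrightarrow> T \<subseteq> E \<and> graph_connected V T \<and> (\<nexists>c. graph_cycle T c)"

section \<open>Posets\<close>

definition hasse_edges :: "'a set \<Rightarrow> 'a rel \<Rightarrow> 'a set set" where
  "hasse_edges A r = {{x, y} | x y. x \<in> A \<and> y \<in> A \<and> (x, y) \<in> r - Id \<and>
     \<not> (\<exists>z\<in>A. (x, z) \<in> r - Id \<and> (z, y) \<in> r - Id)}"

definition minimal_elements :: "'a set \<Rightarrow> 'a rel \<Rightarrow> 'a set" where
  "minimal_elements A r = {b \<in> A. \<not> (\<exists>a\<in>A. (a, b) \<in> r - Id)}"

definition minimal_below :: "'a set \<Rightarrow> 'a rel \<Rightarrow> 'a \<Rightarrow> 'a set" where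
  "minimal_below A r a = {b \<in> minimal_elements A r. (b, a) \<in> r}"

definition sync_edges :: "'a set \<Rightarrow> 'a rel \<Rightarrow> 'a set set" where
  "sync_edges A r = {{b, b'} | b b'. b \<in> minimal_elements A r \<and> b' \<in> minimal_elements A r \<and> b \<noteq> b' \<and>
     (\<exists>a\<in>A. (b, a) \<in> r - Id \<and> (b', a) \<in> r - Id)}"

definition locally_connected :: "'a set \<Rightarrow> 'a rel \<Rightarrow> 'a set set \<Rightarrow> bool" where
  "locally_connected A r T \<longleftrightarrow>
     (\<forall>a\<in>A. graph_connected (minimal_below A r a) (induced_edges T (minimal_below A r a)))"

definition synchronizable :: "'a set \<Rightarrow> 'a rel \<Rightarrow> bool" where
  "synchronizable A r \<longleftrightarrow>
     (\<exists>T. spanning_tree (minimal_elements A r) (sync_edges A r) T \<and> locally_connected A r T)"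

datatype wstar = Wz | Wy nat | Wystar

text \<open>With parameter \<open>n\<close>, the legs are \<open>y\<^sub>0, \<dots>, y\<^sub>n, y\<^sub>*\<close>, that is, \<open>n + 2\<close> of them.\<close>

definition wstar_legs :: "nat \<Rightarrow> wstar set" where
  "wstar_legs n = insert Wystar (Wy ` {0..n})"

definition wstar_carrier :: "nat \<Rightarrow> wstar set" where
  "wstar_carrier n = insert Wz (wstar_legs n)"

definition wstar_order :: "nat \<Rightarrow> wstar rel" where
  "wstar_order n = Id_on (wstar_carrier n) \<union> wstar_legs n \<times> {Wz}"

lemma partial_order_wstar: "partial_order_on (wstar_carrier n) (wstar_order n)"
  by (auto simp: partial_order_on_def preorder_on_def refl_on_def trans_def antisym_def
      wstar_order_def wstar_carrier_def wstar_legs_def)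

section \<open>Monotonicity\<close>

definition up_set :: "'s set \<Rightarrow> 's rel \<Rightarrow> 's set \<Rightarrow> bool" where
  "up_set S s U \<longleftrightarrow> U \<subseteq> S \<and> (\<forall>x\<in>U. \<forall>y\<in>S. (x, y) \<in> s \<longrightarrow> y \<in> U)"

definition stoch_le :: "'s set \<Rightarrow> 's rel \<Rightarrow> 's measure \<Rightarrow> 's measure \<Rightarrow> bool" where
  "stoch_le S s P P' \<longleftrightarrow> (\<forall>U. up_set S s U \<longrightarrow> measure P U \<le> measure P' U)"

definition prob_system :: "'a set \<Rightarrow> 's set \<Rightarrow> ('a \<Rightarrow> 's measure) \<Rightarrow> bool" where
  "prob_system A S P \<longleftrightarrow> (\<forall>c\<in>A. prob_space (P c) \<and> sets (P c) = Pow S)"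

definition stochastically_monotone ::
    "'a set \<Rightarrow> 'a rel \<Rightarrow> 's set \<Rightarrow> 's rel \<Rightarrow> ('a \<Rightarrow> 's measure) \<Rightarrow> bool" where
  "stochastically_monotone A r S s P \<longleftrightarrow>
     (\<forall>a\<in>A. \<forall>b\<in>A. (a, b) \<in> r - Id \<longrightarrow> stoch_le S s (P a) (P b))"

definition realized_by ::
    "'a set \<Rightarrow> 'a rel \<Rightarrow> 's set \<Rightarrow> 's rel \<Rightarrow> ('a \<Rightarrow> 's measure) \<Rightarrow> 'w measure \<Rightarrow> ('a \<Rightarrow> 'w \<Rightarrow> 's) \<Rightarrow> bool"
  where
  "realized_by A r S s P M X \<longleftrightarrow> prob_space M \<and>
     (\<forall>c\<in>A. X c \<in> measurable M (count_space S) \<and> distr M (count_space S) (X c) = P c) \<and>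
     (\<forall>a\<in>A. \<forall>b\<in>A. (a, b) \<in> r - Id \<longrightarrow> (\<forall>w\<in>space M. (X a w, X b w) \<in> s))"

text \<open>
  HOL cannot quantify over the type of the sample space, so sample points are taken to be
  functions from the index set to the state space. Lemma \<open>realizably_monotoneI\<close> below shows that
  this loses nothing.
\<close>

definition realizably_monotone ::
    "'a set \<Rightarrow> 'a rel \<Rightarrow> 's set \<Rightarrow> 's rel \<Rightarrow> ('a \<Rightarrow> 's measure) \<Rightarrow> bool" where
  "realizably_monotone A r S s P \<longleftrightarrow>
     (\<exists>(M :: ('a \<Rightarrow> 's) measure) X. realized_by A r S s P M X)"

lemma realizably_monotoneI:
  fixes M :: "'w measure"
  assumes "realized_by A r S s P M X"
  shows "realizably_monotone A r S s P"
proof -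
  interpret M: prob_space M using assms by (simp add: realized_by_def)
  have X: "X c \<in> measurable M (count_space S)" and D: "distr M (count_space S) (X c) = P c"
    if "c \<in> A" for c using assms that by (auto simp: realized_by_def)
  have mono: "(X a w, X b w) \<in> s" if "a \<in> A" "b \<in> A" "(a, b) \<in> r - Id" "w \<in> space M" for a b w
    using assms that by (auto simp: realized_by_def)
  define F where "F w = (\<lambda>c\<in>A. X c w)" for w
  define N where "N = restrict_space (Pi\<^sub>M A (\<lambda>_. count_space S)) (F ` space M)"
  have "F \<in> measurable M (Pi\<^sub>M A (\<lambda>_. count_space S))"
    unfolding F_def using X by (rule measurable_restrict)
  then have F: "F \<in> measurable M N"
    unfolding N_def by (intro measurable_restrict_space2) auto
  have p: "(\<lambda>f. f c) \<in> measurable N (count_space S)" if "c \<in> A" for c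
    unfolding N_def using that
    by (intro measurable_restrict_space1 measurable_component_singleton)
  have "prob_space (distr M N F)" by (rule M.prob_space_distr[OF F])
  moreover have "distr (distr M N F) (count_space S) (\<lambda>f. f c) = P c" if "c \<in> A" for c
  proof -
    have "distr (distr M N F) (count_space S) (\<lambda>f. f c) = distr M (count_space S) (X c)"
      unfolding distr_distr[OF p[OF that] F]
      by (rule distr_cong) (use that in \<open>auto simp: F_def\<close>)
    then show ?thesis using D[OF that] by simp
  qed
  moreover have "(f a, f b) \<in> s"
    if "a \<in> A" "b \<in> A" "(a, b) \<in> r - Id" "f \<in> space (distr M N F)" for a b f
    using that mono by (auto simp: N_def space_restrict_space F_def)
  ultimately have "realized_by A r S s P (distr M N F) (\<lambda>c f. f c)"
    using p by (auto simp: realized_by_def)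
  then show ?thesis unfolding realizably_monotone_def by blast
qed

definition monotonicity_equivalence_fails ::
    "'a set \<Rightarrow> 'a rel \<Rightarrow> 's set \<Rightarrow> 's rel \<Rightarrow> bool" where
  "monotonicity_equivalence_fails A r S s \<longleftrightarrow>
     (\<exists>P. prob_system A S P \<and> stochastically_monotone A r S s P \<and> \<not> realizably_monotone A r S s P)"

end

theory Submission
  imports Defs
begin

text \<open>
  Write \<open>B(a)\<close> for the set of minimal elements below \<open>a\<close>, and call a set of minimal elements linked
  if it is connected by the sets \<open>B(a)\<close> that it contains. If the linked sets have the Helly property,
  some tree on the minimal elements induces a connected subgraph on every linked set: split off
  a maximal proper linked set \<open>C\<close>; every linked set meeting both \<open>C\<close> and its complement \<open>K\<close>
  contains \<open>K\<close>, and by the Helly property all of these share a point \<open>u\<close> of \<open>C\<close>, so that trees on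
  \<open>C\<close> and on \<open>K\<close> can be joined by an edge at \<open>u\<close>. Such a tree makes the poset synchronizable.

  Otherwise there are pairwise intersecting linked sets \<open>C\<^sub>0, \<dots>, C\<^sub>n\<close> with empty intersection. Let
  \<open>P\<^sub>a\<close> have mass \<open>1 / n\<close> at \<open>y\<^sub>i\<close> whenever \<open>B(a) \<subseteq> C\<^sub>i\<close>, and the rest of its mass at \<open>z\<close>; no \<open>B(a)\<close> lies
  in all \<open>n + 1\<close> sets, so this is possible. In a realization the events \<open>X\<^sub>b = y\<^sub>i\<close> with \<open>b \<in> C\<^sub>i\<close> agree
  almost surely, and for different \<open>i\<close> they are almost surely disjoint because the \<open>C\<^sub>i\<close> intersect:
  \<open>n + 1\<close> disjoint events of probability \<open>1 / n\<close>.
\<close>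

section \<open>Connected graphs and bridges\<close>

lemma sym_adj: "sym (adj E)"
  by (auto simp: adj_def sym_def insert_commute)

lemma adj_rtrancl_sym: "(x, y) \<in> (adj E)\<^sup>* \<Longrightarrow> (y, x) \<in> (adj E)\<^sup>*"
  by (rule symD[OF sym_rtrancl[OF sym_adj]])

lemma adj_mono: "E \<subseteq> F \<Longrightarrow> adj E \<subseteq> adj F"
  by (auto simp: adj_def)

lemma adj_rtrancl_mono: "E \<subseteq> F \<Longrightarrow> (x, y) \<in> (adj E)\<^sup>* \<Longrightarrow> (x, y) \<in> (adj F)\<^sup>*"
  using rtrancl_mono[OF adj_mono] by blast

text \<open>An edge may go to a walk, even the trivial one, so \<open>f\<close> is allowed to
  contract edges.\<close>

lemma adj_rtrancl_map:
  assumes "(x, y) \<in> (adj E)\<^sup>*"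
    and "\<And>a b. {a, b} \<in> E \<Longrightarrow> (f a, f b) \<in> (adj F)\<^sup>*"
  shows "(f x, f y) \<in> (adj F)\<^sup>*"
  using assms(1)
proof induction
  case (step y z)
  then show ?case using assms(2)[of y z] by (auto simp: adj_def)
qed simp

lemma graph_connected_mono: "graph_connected V E \<Longrightarrow> E \<subseteq> F \<Longrightarrow> graph_connected V F"
  by (auto simp: graph_connected_def intro: adj_rtrancl_mono)

lemma graph_connected_via:
  assumes "u \<in> V" "\<And>v. v \<in> V \<Longrightarrow> (u, v) \<in> (adj E)\<^sup>*"
  shows "graph_connected V E"
  unfolding graph_connected_def
proof (intro conjI ballI)
  show "(x, y) \<in> (adj E)\<^sup>*" if "x \<in> V" "y \<in> V" for x y
    by (rule rtrancl_trans[OF adj_rtrancl_sym[OF assms(2)[OF that(1)]] assms(2)[OF that(2)]])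
qed (use assms(1) in blast)

lemma graph_connected_Un:
  assumes "graph_connected V E" "graph_connected W E" "V \<inter> W \<noteq> {}"
  shows "graph_connected (V \<union> W) E"
proof -
  obtain u where "u \<in> V" "u \<in> W" using assms(3) by blast
  then show ?thesis
    using assms(1,2) by (intro graph_connected_via[of u]) (auto simp: graph_connected_def)
qed

lemma graph_connected_join:
  assumes "graph_connected V E" "graph_connected W E" "u \<in> V" "w \<in> W" "{u, w} \<in> E"
  shows "graph_connected (V \<union> W) E"
proof (rule graph_connected_via[of u])
  have "(u, w) \<in> adj E" using assms(5) by (simp add: adj_def)
  then show "(u, v) \<in> (adj E)\<^sup>*" if "v \<in> V \<union> W" for v
    using that assms by (auto simp: graph_connected_def intro: converse_rtrancl_into_rtrancl)
qed (use assms in simp)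

text \<open>Acyclicity stated through reachability: this form passes to subsets and survives joining
  two trees, without handling cycles as lists. Loops are excluded too, since a point always reaches
  itself.\<close>

definition all_bridges :: "'a set set \<Rightarrow> bool" where
  "all_bridges T \<longleftrightarrow> (\<forall>a b. {a, b} \<in> T \<longrightarrow> (a, b) \<notin> (adj (T - {{a, b}}))\<^sup>*)"

lemma all_bridges_mono: "all_bridges T \<Longrightarrow> S \<subseteq> T \<Longrightarrow> all_bridges S"
  unfolding all_bridges_def by (meson Diff_mono adj_rtrancl_mono order_refl subsetD)

lemma all_bridges_no_loop: "all_bridges T \<Longrightarrow> {x} \<notin> T"
  by (auto simp: all_bridges_def dest!: spec[of _ x])

text \<open>The rest of a cycle is a detour around its first edge, so that edge cannot be a
  bridge.\<close>

lemma all_bridges_no_cycle: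
  assumes "all_bridges T"
  shows "\<not> graph_cycle T c"
proof
  assume c: "graph_cycle T c"
  let ?m = "length c" and ?e = "{c ! 0, c ! 1}"
  have m: "3 \<le> ?m" and d: "distinct c"
    and ed: "\<And>i. i < ?m \<Longrightarrow> {c ! i, c ! (Suc i mod ?m)} \<in> T"
    using c by (auto simp: graph_cycle_def)
  have ne: "c ! i \<noteq> c ! j" if "i < ?m" "j < ?m" "i \<noteq> j" for i j
    using d that by (simp add: nth_eq_iff_index_eq)
  have reach: "(c ! 1, c ! Suc i) \<in> (adj (T - {?e}))\<^sup>*" if "Suc i < ?m" for i
    using that
  proof (induction i)
    case (Suc i)
    then have "{c ! Suc i, c ! Suc (Suc i)} \<in> T" using ed[of "Suc i"] by simp
    moreover have "c ! Suc i \<noteq> c ! 0" "c ! Suc (Suc i) \<noteq> c ! 0"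
      by (rule ne; use Suc.prems in linarith)+
    ultimately have "(c ! Suc i, c ! Suc (Suc i)) \<in> adj (T - {?e})"
      by (auto simp: adj_def doubleton_eq_iff)
    then show ?case using Suc by (auto intro: rtrancl_into_rtrancl)
  qed simp
  \<comment> \<open>Length at least 3 makes the last vertex differ from \<open>c ! 1\<close>, so the
    closing edge is not the deleted one.\<close>
  have "c ! (?m - 1) \<noteq> c ! 0" "c ! (?m - 1) \<noteq> c ! 1"
    by (rule ne; use m in linarith)+
  moreover have "Suc (?m - 1) = ?m" using m by simp
  then have "{c ! (?m - 1), c ! 0} \<in> T" using ed[of "?m - 1"] by simp
  ultimately have "(c ! (?m - 1), c ! 0) \<in> adj (T - {?e})"
    by (auto simp: adj_def doubleton_eq_iff)
  moreover have "(c ! 1, c ! (?m - 1)) \<in> (adj (T - {?e}))\<^sup>*" using reach[of "?m - 2"] m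
    by (simp add: numeral_2_eq_2 Suc_diff_Suc)
  ultimately have "(c ! 1, c ! 0) \<in> (adj (T - {?e}))\<^sup>*" by (rule rtrancl_into_rtrancl[rotated])
  then have "(c ! 0, c ! 1) \<in> (adj (T - {?e}))\<^sup>*" by (rule adj_rtrancl_sym)
  moreover have "?e \<in> T" using ed[of 0] m by (cases "c = []") auto
  ultimately show False using assms by (auto simp: all_bridges_def)
qed

lemma all_bridges_join:
  assumes T1: "all_bridges T1" "\<Union>T1 \<subseteq> V" and T2: "all_bridges T2" "\<Union>T2 \<subseteq> W"
    and disj: "V \<inter> W = {}" and "u \<in> V" "w \<in> W"
  shows "all_bridges (insert {u, w} (T1 \<union> T2))"
proof -
  \<comment> \<open>Collapsing the other side onto the endpoint of the joining edge turns a detour around an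
    edge of \<open>P\<close> in the joined graph into one inside \<open>P\<close>.\<close>
  have side: "(a, b) \<notin> (adj (insert {p, q} (P \<union> Q) - {{a, b}}))\<^sup>*"
    if P: "all_bridges P" "\<Union>P \<subseteq> X" and Q: "\<Union>Q \<subseteq> Y"
      and XY: "X \<inter> Y = {}" "p \<in> X" "q \<in> Y" and ab: "{a, b} \<in> P"
    for P Q :: "'a set set" and X Y p q a b
  proof
    assume "(a, b) \<in> (adj (insert {p, q} (P \<union> Q) - {{a, b}}))\<^sup>*"
    then have "((\<lambda>v. if v \<in> X then v else p) a, (\<lambda>v. if v \<in> X then v else p) b)
        \<in> (adj (P - {{a, b}}))\<^sup>*"
    proof (rule adj_rtrancl_map)
      fix x y assume e: "{x, y} \<in> insert {p, q} (P \<union> Q) - {{a, b}}"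
      consider "{x, y} = {p, q}" | "{x, y} \<in> P" | "{x, y} \<in> Q" using e by blast
      then show "((\<lambda>v. if v \<in> X then v else p) x, (\<lambda>v. if v \<in> X then v else p) y)
          \<in> (adj (P - {{a, b}}))\<^sup>*"
      proof cases
        case 1
        then show ?thesis using XY by (auto simp: doubleton_eq_iff)
      next
        case 2
        then have "x \<in> X" "y \<in> X" using P by blast+
        moreover have "(x, y) \<in> adj (P - {{a, b}})" using 2 e by (simp add: adj_def)
        ultimately show ?thesis by auto
      next
        case 3
        then have "x \<in> Y" "y \<in> Y" using Q by blast+
        then show ?thesis using XY by auto
      qed
    qed
    moreover have "a \<in> X" "b \<in> X" using ab P by blast+
    ultimately show False using P ab by (auto simp: all_bridges_def)
  qed
  \<comment> \<open>With the joining edge removed, no walk leaves \<open>V\<close>: edges of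
    \<open>T1\<close> stay in \<open>V\<close>, and those of \<open>T2\<close> never touch
    it.\<close>
  have cut: "y \<in> V" if "(x, y) \<in> (adj (insert {u, w} (T1 \<union> T2) - {{u, w}}))\<^sup>*" "x \<in> V" for x y
    using that
  proof induction
    case (step y z)
    then have "{y, z} \<in> T1 \<union> T2" by (auto simp: adj_def)
    then show ?case using step T1 T2 disj by blast
  qed simp
  show ?thesis
    unfolding all_bridges_def
  proof (intro allI impI)
    fix a b assume "{a, b} \<in> insert {u, w} (T1 \<union> T2)"
    then consider "{a, b} = {u, w}" | "{a, b} \<in> T1" | "{a, b} \<in> T2" by blast
    then show "(a, b) \<notin> (adj (insert {u, w} (T1 \<union> T2) - {{a, b}}))\<^sup>*"
    proof cases
      case 1
      have "(u, w) \<notin> (adj (insert {u, w} (T1 \<union> T2) - {{u, w}}))\<^sup>*"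
        using cut[of u w] assms by blast
      then show ?thesis using 1 adj_rtrancl_sym by (metis doubleton_eq_iff)
    next
      case 2
      then show ?thesis using side[of T1 V T2 W u w a b] assms by blast
    next
      case 3
      then show ?thesis using side[of T2 W T1 V w u a b] assms
        by (simp add: Int_commute Un_commute insert_commute)
    qed
  qed
qed

section \<open>Helly families of subtrees\<close>

text \<open>The pairs with \<open>X = Y\<close> are included, so pairwise intersecting families
  consist of nonempty sets.\<close>

definition helly :: "'a set set \<Rightarrow> bool" where
  "helly \<C> \<longleftrightarrow> (\<forall>F\<subseteq>\<C>. F \<noteq> {} \<and> (\<forall>X\<in>F. \<forall>Y\<in>F. X \<inter> Y \<noteq> {}) \<longrightarrow> \<Inter>F \<noteq> {})"

lemma hellyD:
  assumes "helly \<C>" "F \<subseteq> \<C>" "F \<noteq> {}" "\<And>X Y. X \<in> F \<Longrightarrow> Y \<in> F \<Longrightarrow> X \<inter> Y \<noteq> {}"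
  shows "\<Inter>F \<noteq> {}"
  using assms unfolding helly_def by blast

text \<open>Lift the traces to members of \<open>\<C>\<close> and adjoin \<open>C\<close> itself.
  The enlarged family still meets pairwise, and its common point lies in \<open>C\<close>, hence in
  every trace.\<close>

lemma helly_trace:
  assumes "helly \<C>" "C \<in> \<C>"
  shows "helly ((\<lambda>X. X \<inter> C) ` \<C>)"
  unfolding helly_def
proof (intro allI impI, elim conjE)
  fix F assume F: "F \<subseteq> (\<lambda>X. X \<inter> C) ` \<C>" "F \<noteq> {}" "\<forall>X\<in>F. \<forall>Y\<in>F. X \<inter> Y \<noteq> {}"
  let ?G = "{X \<in> \<C>. X \<inter> C \<in> F}"
  obtain G0 where "G0 \<in> F" using F(2) by blast
  then have "C \<noteq> {}" using F by blast
  have "\<Inter>(insert C ?G) \<noteq> {}"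
  proof (rule hellyD[OF assms(1)])
    fix X Y assume X: "X \<in> insert C ?G" and Y: "Y \<in> insert C ?G"
    have *: "X \<inter> C \<noteq> {}" "Y \<inter> C \<noteq> {}" using X Y F(3) \<open>C \<noteq> {}\<close> by blast+
    show "X \<inter> Y \<noteq> {}"
    proof (cases "X = C \<or> Y = C")
      case True then show ?thesis using * by blast
    next
      case False
      then have "X \<inter> C \<in> F" "Y \<inter> C \<in> F" using X Y by auto
      then have "(X \<inter> C) \<inter> (Y \<inter> C) \<noteq> {}" using F(3) by blast
      then show ?thesis by blast
    qed
  qed (use assms in auto)
  then obtain x where x: "x \<in> C" "\<And>X. X \<in> ?G \<Longrightarrow> x \<in> X" by blast
  have "x \<in> Y" if Y: "Y \<in> F" for Y
  proof -
    obtain X where "X \<in> \<C>" "Y = X \<inter> C" using Y F(1) by blast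
    then show ?thesis using x(1) x(2)[of X] Y by simp
  qed
  then show "\<Inter>F \<noteq> {}" by blast
qed

text \<open>Adjoining a nonempty set that contains all the others does not shrink any intersection.
  It will be applied to a complement \<open>K\<close>, which may lie outside
  \<open>\<C>\<close>.\<close>

lemma helly_below:
  assumes "helly \<C>" "K \<noteq> {}"
  shows "helly (insert K {X \<in> \<C>. X \<subseteq> K})"
  unfolding helly_def
proof (intro allI impI, elim conjE)
  fix F assume F: "F \<subseteq> insert K {X \<in> \<C>. X \<subseteq> K}" "F \<noteq> {}" "\<forall>X\<in>F. \<forall>Y\<in>F. X \<inter> Y \<noteq> {}"
  show "\<Inter>F \<noteq> {}"
  proof (cases "F \<subseteq> {K}")
    case True
    then show ?thesis using F(2) assms(2) by (auto dest: subset_singletonD)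
  next
    case False
    have "\<Inter>(F - {K}) \<noteq> {}"
      using F False by (intro hellyD[OF assms(1)]) auto
    moreover have "\<Inter>(F - {K}) \<subseteq> K" using F(1) False by blast
    ultimately show ?thesis by blast
  qed
qed

theorem helly_tree:
  assumes "finite V" "V \<noteq> {}" "\<C> \<subseteq> Pow V" "helly \<C>" "V \<in> \<C>"
    and "\<And>x. x \<in> V \<Longrightarrow> {x} \<in> \<C>"
    and "\<And>X Y. X \<in> \<C> \<Longrightarrow> Y \<in> \<C> \<Longrightarrow> X \<inter> Y \<noteq> {} \<Longrightarrow> X \<union> Y \<in> \<C>"
  shows "\<exists>T. \<Union>T \<subseteq> V \<and> all_bridges T \<and>
    (\<forall>X\<in>\<C>. X \<noteq> {} \<longrightarrow> graph_connected X (induced_edges T X))"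
  using assms
proof (induction V arbitrary: \<C> rule: finite_psubset_induct)
  case (psubset V \<C>)
  note sub = psubset.prems(2) and hel = psubset.prems(3)
    and sing = psubset.prems(5) and un = psubset.prems(6)
  show ?case
  proof (cases "\<exists>x. V = {x}")
    case True
    then obtain x where "V = {x}" by blast
    then have "X = {x}" if "X \<in> \<C>" "X \<noteq> {}" for X
      using sub that by blast
    then have "graph_connected X (induced_edges {} X)" if "X \<in> \<C>" "X \<noteq> {}" for X
      using that by (intro graph_connected_via[of x]) auto
    then show ?thesis by (intro exI[of _ "{}"]) (simp add: all_bridges_def)
  next
    case False
    let ?Q = "{X \<in> \<C>. X \<noteq> {} \<and> X \<noteq> V}"
    obtain x where "x \<in> V" using psubset.prems(1) by blast
    then have "{x} \<in> ?Q" using sing False by blast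
    moreover have "finite ?Q" using sub psubset.hyps by (auto intro: finite_subset[of _ "Pow V"])
    ultimately obtain C where C: "C \<in> ?Q" and Cmax: "\<And>X. X \<in> ?Q \<Longrightarrow> C \<subseteq> X \<Longrightarrow> X = C"
      using finite_has_maximal[of ?Q] by blast
    have CV: "C \<in> \<C>" "C \<noteq> {}" "C \<subset> V" using C sub by auto
    define K where "K = V - C"
    have K: "K \<noteq> {}" "K \<subset> V" "C \<inter> K = {}" "C \<union> K = V" using CV by (auto simp: K_def)
    \<comment> \<open>Closure under unions makes \<open>X \<union> C\<close> a member properly
      larger than \<open>C\<close>; by maximality it is all of \<open>V\<close>.\<close>
    have crossing: "K \<subseteq> X" if "X \<in> \<C>" "X \<inter> C \<noteq> {}" "X \<inter> K \<noteq> {}" for X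
    proof -
      have "X \<union> C \<in> \<C>" using un that CV by blast
      then have "X \<union> C = V" using Cmax[of "X \<union> C"] that CV K by blast
      then show ?thesis by (auto simp: K_def)
    qed
    \<comment> \<open>Two crossing sets share \<open>K\<close>, and each meets \<open>C\<close>.
      Including \<open>C\<close> places the common point \<open>u\<close> in
      \<open>C\<close>.\<close>
    let ?F = "insert C {X \<in> \<C>. X \<inter> C \<noteq> {} \<and> X \<inter> K \<noteq> {}}"
    have "\<Inter>?F \<noteq> {}"
    proof (rule hellyD[OF hel])
      fix X Y assume "X \<in> ?F" "Y \<in> ?F"
      then show "X \<inter> Y \<noteq> {}" using crossing[of X] crossing[of Y] K(1) CV(2) by blast
    qed (use CV in auto)
    then obtain u where u: "u \<in> C" "\<And>X. X \<in> \<C> \<Longrightarrow> X \<inter> C \<noteq> {} \<Longrightarrow> X \<inter> K \<noteq> {} \<Longrightarrow> u \<in> X"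
      by blast
    \<comment> \<open>Any point of \<open>K\<close> will do, since every crossing set contains all
      of \<open>K\<close>.\<close>
    obtain k where k: "k \<in> K" using K(1) by blast
    \<comment> \<open>On \<open>C\<close> all traces are kept, because the part of a crossing set in
      \<open>C\<close> must be connected by \<open>T1\<close> alone. On \<open>K\<close> a crossing
      set leaves the trace \<open>K\<close>, so adjoining \<open>K\<close> suffices.\<close>
    let ?CC = "(\<lambda>X. X \<inter> C) ` \<C>" and ?CK = "insert K {X \<in> \<C>. X \<subseteq> K}"
    have "\<exists>T. \<Union>T \<subseteq> C \<and> all_bridges T \<and>
        (\<forall>X\<in>?CC. X \<noteq> {} \<longrightarrow> graph_connected X (induced_edges T X))"
    proof (rule psubset.IH)
      show "{x} \<in> ?CC" if "x \<in> C" for x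
        using sing[of x] that CV by (intro image_eqI[of _ _ "{x}"]) auto
      show "X \<union> Y \<in> ?CC" if XY: "X \<in> ?CC" "Y \<in> ?CC" "X \<inter> Y \<noteq> {}" for X Y
      proof -
        obtain X' Y' where "X' \<in> \<C>" "Y' \<in> \<C>" "X = X' \<inter> C" "Y = Y' \<inter> C" using XY by blast
        then show ?thesis using un[of X' Y'] XY(3) by (intro image_eqI[of _ _ "X' \<union> Y'"]) auto
      qed
      show "helly ?CC" by (rule helly_trace[OF hel CV(1)])
      show "C \<in> ?CC" using CV by blast
    qed (use CV in auto)
    then obtain T1 where T1: "\<Union>T1 \<subseteq> C" "all_bridges T1"
      and T1CC: "\<forall>X\<in>?CC. X \<noteq> {} \<longrightarrow> graph_connected X (induced_edges T1 X)"
      by (elim exE conjE)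
    have T1c: "graph_connected (X \<inter> C) (induced_edges T1 (X \<inter> C))"
      if "X \<in> \<C>" "X \<inter> C \<noteq> {}" for X
      using bspec[OF T1CC imageI[OF that(1)]] that(2) by (rule mp)
    have "\<exists>T. \<Union>T \<subseteq> K \<and> all_bridges T \<and>
        (\<forall>X\<in>?CK. X \<noteq> {} \<longrightarrow> graph_connected X (induced_edges T X))"
    proof (rule psubset.IH)
      show "helly ?CK" by (rule helly_below[OF hel K(1)])
      show "{x} \<in> ?CK" if "x \<in> K" for x using sing[of x] that K by blast
      show "X \<union> Y \<in> ?CK" if "X \<in> ?CK" "Y \<in> ?CK" "X \<inter> Y \<noteq> {}" for X Y
        using that un[of X Y] by (auto simp: Un_absorb1 Un_absorb2)
    qed (use K in auto)
    then obtain T2 where T2: "\<Union>T2 \<subseteq> K" "all_bridges T2"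
      and T2CK: "\<forall>X\<in>?CK. X \<noteq> {} \<longrightarrow> graph_connected X (induced_edges T2 X)"
      by (elim exE conjE)
    have T2K: "graph_connected K (induced_edges T2 K)"
      using T2CK K(1) by simp
    have T2c: "graph_connected X (induced_edges T2 X)" if "X \<in> \<C>" "X \<noteq> {}" "X \<subseteq> K" for X
      using T2CK that by simp
    let ?T = "insert {u, k} (T1 \<union> T2)"
    have "graph_connected X (induced_edges ?T X)" if X: "X \<in> \<C>" "X \<noteq> {}" for X
    proof -
      consider "X \<inter> K = {}" | "X \<inter> C = {}" | "X \<inter> C \<noteq> {}" "X \<inter> K \<noteq> {}" by blast
      then show ?thesis
      proof cases
        case 1
        then have "X \<inter> C = X" using X sub K by blast
        then have "graph_connected X (induced_edges T1 X)" using T1c[of X] X by simp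
        then show ?thesis by (rule graph_connected_mono) (auto simp: induced_edges_def)
      next
        case 2
        then have "X \<subseteq> K" using X sub K by blast
        then have "graph_connected X (induced_edges T2 X)" using T2c[of X] X by simp
        then show ?thesis by (rule graph_connected_mono) (auto simp: induced_edges_def)
      next
        case 3
        have KX: "K \<subseteq> X" and uX: "u \<in> X" using crossing u(2) X 3 by auto
        have "graph_connected ((X \<inter> C) \<union> K) (induced_edges ?T X)"
        proof (rule graph_connected_join)
          show "graph_connected (X \<inter> C) (induced_edges ?T X)"
            by (rule graph_connected_mono[OF T1c[OF X(1) 3(1)]]) (auto simp: induced_edges_def)
          show "graph_connected K (induced_edges ?T X)"
            by (rule graph_connected_mono[OF T2K]) (use KX in \<open>auto simp: induced_edges_def\<close>)
          show "{u, k} \<in> induced_edges ?T X" using KX uX k by (auto simp: induced_edges_def)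
        qed (use uX u k in auto)
        moreover have "(X \<inter> C) \<union> K = X" using KX X sub K by blast
        ultimately show ?thesis by simp
      qed
    qed
    moreover have "all_bridges ?T" using all_bridges_join[OF T1(2,1) T2(2,1)] K u k by blast
    moreover have "\<Union>?T \<subseteq> V" using T1 T2 K u k by auto
    ultimately show ?thesis by (intro exI[of _ ?T]) simp
  qed
qed

section \<open>Minimal elements\<close>

lemma minimal_below_mono:
  assumes "partial_order_on A r" "(a, b) \<in> r"
  shows "minimal_below A r a \<subseteq> minimal_below A r b"
  using assms unfolding minimal_below_def partial_order_on_def preorder_on_def trans_def by blast

lemma minimal_below_minimal:
  assumes "partial_order_on A r" "b \<in> minimal_elements A r"
  shows "minimal_below A r b = {b}"
  using assms
  by (auto simp: minimal_below_def minimal_elements_def partial_order_on_def preorder_on_def refl_on_def)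

text \<open>Descent: passing to a strictly smaller element loses \<open>a\<close> itself from the
  finite set of elements below.\<close>

lemma minimal_below_nonempty:
  assumes "finite A" "partial_order_on A r" "a \<in> A"
  shows "minimal_below A r a \<noteq> {}"
  using assms(3)
proof (induction "card {x \<in> A. (x, a) \<in> r}" arbitrary: a rule: less_induct)
  case less
  show ?case
  proof (cases "a \<in> minimal_elements A r")
    case True
    then show ?thesis using minimal_below_minimal[OF assms(2)] by simp
  next
    case False
    then obtain x where x: "x \<in> A" "(x, a) \<in> r" "x \<noteq> a"
      using less.prems by (auto simp: minimal_elements_def)
    have "(a, a) \<in> r" "(a, x) \<notin> r" and tr: "\<And>y. (y, x) \<in> r \<Longrightarrow> (y, a) \<in> r"
      using assms(2) x less.prems
      unfolding partial_order_on_def preorder_on_def refl_on_def antisym_def trans_def by blast+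
    then have "{y \<in> A. (y, x) \<in> r} \<subset> {y \<in> A. (y, a) \<in> r}" using less.prems by blast
    then have "minimal_below A r x \<noteq> {}"
      using less.hyps[of x] x(1) assms(1) by (simp add: psubset_card_mono)
    then show ?thesis using minimal_below_mono[OF assms(2) x(2)] by blast
  qed
qed

section \<open>Linked sets of minimal elements\<close>

text \<open>Each \<open>minimal_below A r a\<close> inside \<open>C\<close> becomes a clique, so
  hypergraph connectivity turns into graph connectivity. The case \<open>b = b'\<close> adds loops,
  which are harmless.\<close>

definition below_edges :: "'a set \<Rightarrow> 'a rel \<Rightarrow> 'a set \<Rightarrow> 'a set set" where
  "below_edges A r C = {{b, b'} | b b'. \<exists>a\<in>A. minimal_below A r a \<subseteq> C \<and>
     b \<in> minimal_below A r a \<and> b' \<in> minimal_below A r a}"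

definition linked_sets :: "'a set \<Rightarrow> 'a rel \<Rightarrow> 'a set set" where
  "linked_sets A r = {C. C \<subseteq> minimal_elements A r \<and> graph_connected C (below_edges A r C)}"

lemma below_edges_mono: "C \<subseteq> C' \<Longrightarrow> below_edges A r C \<subseteq> below_edges A r C'"
  unfolding below_edges_def by blast

lemma below_edgesE:
  assumes "(x, y) \<in> adj (below_edges A r C)"
  obtains a where "a \<in> A" "minimal_below A r a \<subseteq> C" "x \<in> minimal_below A r a" "y \<in> minimal_below A r a"
  using assms unfolding adj_def below_edges_def by (auto simp: doubleton_eq_iff)

lemma adj_below_edgesI:
  "a \<in> A \<Longrightarrow> minimal_below A r a \<subseteq> C \<Longrightarrow> x \<in> minimal_below A r a \<Longrightarrow> y \<in> minimal_below A r a
    \<Longrightarrow> (x, y) \<in> adj (below_edges A r C)"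
  unfolding adj_def below_edges_def by auto

lemma minimal_below_linked:
  assumes "finite A" "partial_order_on A r" "a \<in> A"
  shows "minimal_below A r a \<in> linked_sets A r"
proof -
  have "minimal_below A r a \<subseteq> minimal_elements A r" by (auto simp: minimal_below_def)
  moreover have "graph_connected (minimal_below A r a) (below_edges A r (minimal_below A r a))"
    unfolding graph_connected_def
    using minimal_below_nonempty[OF assms] adj_below_edgesI[OF assms(3) order_refl] by blast
  ultimately show ?thesis by (simp add: linked_sets_def)
qed

lemma linked_sets_Un:
  assumes "X \<in> linked_sets A r" "Y \<in> linked_sets A r" "X \<inter> Y \<noteq> {}"
  shows "X \<union> Y \<in> linked_sets A r"
proof -
  have "graph_connected X (below_edges A r (X \<union> Y))" "graph_connected Y (below_edges A r (X \<union> Y))"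
    using assms(1,2) by (auto simp: linked_sets_def intro: graph_connected_mono[OF _ below_edges_mono])
  then show ?thesis
    using graph_connected_Un[OF _ _ assms(3)] assms(1,2) by (auto simp: linked_sets_def)
qed

text \<open>Connectedness of the Hasse diagram enters here: the ends of a Hasse edge have nested
  sets of minimal elements below them, and the larger set is a clique.\<close>

lemma minimal_elements_linked:
  assumes "finite A" "partial_order_on A r" "graph_connected A (hasse_edges A r)"
  shows "minimal_elements A r \<in> linked_sets A r"
proof -
  let ?D = "minimal_elements A r" and ?B = "minimal_below A r"
  let ?R = "(adj (below_edges A r ?D))\<^sup>*"
  have BD: "?B a \<subseteq> ?D" for a by (auto simp: minimal_below_def)
  have reach: "\<forall>b\<in>?B x. \<forall>b'\<in>?B y. (b, b') \<in> ?R"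
    if "x \<in> A" "(x, y) \<in> (adj (hasse_edges A r))\<^sup>*" for x y
    using that(2)
  proof induction
    case base
    then show ?case using adj_below_edgesI[OF that(1) BD] by blast
  next
    case (step y z)
    then have yz: "y \<in> A" "z \<in> A" "(y, z) \<in> r \<or> (z, y) \<in> r"
      by (auto simp: adj_def hasse_edges_def doubleton_eq_iff)
    then have "?B y \<subseteq> ?B z \<or> ?B z \<subseteq> ?B y" using minimal_below_mono[OF assms(2)] by blast
    then have cl: "(b, b') \<in> adj (below_edges A r ?D)" if "b \<in> ?B y" "b' \<in> ?B z" for b b'
      using that adj_below_edgesI[OF yz(1) BD] adj_below_edgesI[OF yz(2) BD] by blast
    obtain c where c: "c \<in> ?B y" using minimal_below_nonempty[OF assms(1,2) yz(1)] by blast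
    show ?case
      using step.IH c cl[OF c] by (meson rtrancl_into_rtrancl)
  qed
  have "(b, b') \<in> ?R" if bb: "b \<in> ?D" "b' \<in> ?D" for b b'
  proof -
    have bA: "b \<in> A" "b' \<in> A" using bb by (auto simp: minimal_elements_def)
    then have "(b, b') \<in> (adj (hasse_edges A r))\<^sup>*"
      using assms(3) by (simp add: graph_connected_def)
    then show ?thesis
      using reach[OF bA(1)] minimal_below_minimal[OF assms(2) bb(1)]
        minimal_below_minimal[OF assms(2) bb(2)] by simp
  qed
  moreover have "?D \<noteq> {}"
  proof -
    obtain a where "a \<in> A" using assms(3) by (auto simp: graph_connected_def)
    then show ?thesis using minimal_below_nonempty[OF assms(1,2)] BD by blast
  qed
  ultimately show ?thesis by (simp add: linked_sets_def graph_connected_def)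
qed

lemma helly_synchronizable:
  assumes A: "finite A" "partial_order_on A r" "graph_connected A (hasse_edges A r)"
    and hel: "helly (linked_sets A r)"
  shows "synchronizable A r"
proof -
  let ?D = "minimal_elements A r" and ?B = "minimal_below A r"
  have D: "?D \<in> linked_sets A r" by (rule minimal_elements_linked[OF A])
  have B: "?B a \<in> linked_sets A r" "?B a \<noteq> {}" if "a \<in> A" for a
    using that minimal_below_linked[OF A(1,2)] minimal_below_nonempty[OF A(1,2)] by auto
  have DA: "?D \<subseteq> A" by (auto simp: minimal_elements_def)
  have "\<exists>T. \<Union>T \<subseteq> ?D \<and> all_bridges T \<and>
    (\<forall>X\<in>linked_sets A r. X \<noteq> {} \<longrightarrow> graph_connected X (induced_edges T X))"
  proof (rule helly_tree[OF _ _ _ hel D])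
    show "finite ?D" using finite_subset[OF DA A(1)] .
    show "?D \<noteq> {}" using D by (simp add: linked_sets_def graph_connected_def)
    show "linked_sets A r \<subseteq> Pow ?D" by (auto simp: linked_sets_def)
    show "{x} \<in> linked_sets A r" if "x \<in> ?D" for x
      using B(1)[of x] minimal_below_minimal[OF A(2) that] that DA by auto
  qed (rule linked_sets_Un)
  then obtain T where T: "all_bridges T"
    and Tc: "\<And>X. X \<in> linked_sets A r \<Longrightarrow> X \<noteq> {} \<Longrightarrow> graph_connected X (induced_edges T X)"
    by auto
  \<comment> \<open>The intersection puts the tree inside the synchronization graph. It costs no
    edge within any \<open>?B a\<close>, and global connectivity is then recovered from these local
    pieces.\<close>
  define S where "S = T \<inter> sync_edges A r"
  have edge: "{x, y} \<in> sync_edges A r"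
    if "a \<in> A" "x \<in> ?B a" "y \<in> ?B a" "x \<noteq> y" for a x y
  proof -
    \<comment> \<open>If \<open>a\<close> were minimal, \<open>?B a\<close> would be a singleton;
      the strict relations in \<open>sync_edges\<close> follow.\<close>
    have "x \<noteq> a" "y \<noteq> a"
      using that minimal_below_minimal[OF A(2), of a] by (auto simp: minimal_below_def)
    then show ?thesis using that by (auto simp: sync_edges_def minimal_below_def)
  qed
  have loc: "graph_connected (?B a) (induced_edges S (?B a))" if a: "a \<in> A" for a
  proof -
    have "adj (induced_edges T (?B a)) \<subseteq> adj (induced_edges S (?B a))"
    proof
      fix e assume e: "e \<in> adj (induced_edges T (?B a))"
      obtain x y where xy: "e = (x, y)" by (cases e)
      have *: "{x, y} \<in> T" "x \<in> ?B a" "y \<in> ?B a" using e xy by (auto simp: adj_def induced_edges_def)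
      then have "x \<noteq> y" using all_bridges_no_loop[OF T] by auto
      then show "e \<in> adj (induced_edges S (?B a))"
        using * xy edge[OF a] by (auto simp: adj_def induced_edges_def S_def)
    qed
    then show ?thesis
      using Tc[OF B[OF a]] rtrancl_mono unfolding graph_connected_def by (meson subsetD)
  qed
  have "graph_connected ?D S"
    unfolding graph_connected_def
  proof (intro conjI ballI)
    show "?D \<noteq> {}" using D by (simp add: linked_sets_def graph_connected_def)
    fix b b' assume "b \<in> ?D" "b' \<in> ?D"
    then have "(b, b') \<in> (adj (below_edges A r ?D))\<^sup>*"
      using D by (simp add: linked_sets_def graph_connected_def)
    then show "(b, b') \<in> (adj S)\<^sup>*"
    proof induction
      case (step y z)
      obtain a where a: "a \<in> A" "y \<in> ?B a" "z \<in> ?B a" by (rule below_edgesE[OF step.hyps(2)])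
      then have "(y, z) \<in> (adj (induced_edges S (?B a)))\<^sup>*"
        using loc by (simp add: graph_connected_def)
      then have "(y, z) \<in> (adj S)\<^sup>*"
        by (rule adj_rtrancl_mono[rotated]) (auto simp: induced_edges_def)
      then show ?case using step.IH by (rule rtrancl_trans[rotated])
    qed simp
  qed
  moreover have "\<nexists>c. graph_cycle S c"
    using all_bridges_no_cycle[OF all_bridges_mono[OF T]] by (auto simp: S_def)
  ultimately have "spanning_tree ?D (sync_edges A r) S" by (simp add: spanning_tree_def S_def)
  moreover have "locally_connected A r S" using loc by (simp add: locally_connected_def)
  ultimately show ?thesis unfolding synchronizable_def by blast
qed

section \<open>The counterexample system\<close>

lemma realized_by_measure:
  assumes "realized_by A r S s P M X" "c \<in> A" "x \<in> S"
  shows "measure M {w \<in> space M. X c w = x} = measure (P c) {x}"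
    and "{w \<in> space M. X c w = x} \<in> sets M"
proof -
  have X: "X c \<in> measurable M (count_space S)" and P: "distr M (count_space S) (X c) = P c"
    using assms by (auto simp: realized_by_def)
  have eq: "{w \<in> space M. X c w = x} = X c -` {x} \<inter> space M" by auto
  show "{w \<in> space M. X c w = x} \<in> sets M"
    unfolding eq by (rule measurable_sets[OF X]) (use assms(3) in simp)
  show "measure M {w \<in> space M. X c w = x} = measure (P c) {x}"
    unfolding eq P[symmetric] by (rule measure_distr[OF X, symmetric]) (use assms(3) in simp)
qed

text \<open>Legs are minimal, so \<open>X a w = Wy i\<close> forces \<open>X b w = Wy i\<close>.
  Nested events of equal probability differ by a null set.\<close>

lemma realized_legs_agree:
  assumes R: "realized_by A r (wstar_carrier n) (wstar_order n) P M X"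
    and ab: "a \<in> A" "b \<in> A" "(b, a) \<in> r" and "i \<le> n"
    and eq: "measure (P a) {Wy i} = measure (P b) {Wy i}"
  shows "AE w in M. X a w = Wy i \<longleftrightarrow> X b w = Wy i"
proof (cases "a = b")
  case False
  interpret prob_space M using R by (simp add: realized_by_def)
  let ?E = "\<lambda>c. {w \<in> space M. X c w = Wy i}"
  have i: "Wy i \<in> wstar_carrier n" using assms(5) by (simp add: wstar_carrier_def wstar_legs_def)
  note m = realized_by_measure[OF R _ i]
  have sub: "?E a \<subseteq> ?E b"
  proof
    fix w assume w: "w \<in> ?E a"
    moreover have "\<forall>w\<in>space M. (X b w, X a w) \<in> wstar_order n"
      using R ab False by (auto simp: realized_by_def)
    ultimately have "(X b w, X a w) \<in> wstar_order n" by blast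
    then show "w \<in> ?E b" using w by (auto simp: wstar_order_def)
  qed
  have "prob (?E b - ?E a) = 0"
    using finite_measure_Diff[OF m(2)[OF ab(2)] m(2)[OF ab(1)] sub] m(1) ab eq by simp
  then have "?E b - ?E a \<in> null_sets M"
    using m(2) ab by (auto simp: null_sets_def emeasure_eq_measure)
  then show ?thesis
    by (rule AE_I') (use sub in auto)
qed simp

text \<open>The leg \<open>Wystar\<close> carries no mass. The mass at \<open>Wz\<close> is whatever
  the legs leave over; it is nonnegative, for \<open>n \<ge> 1\<close>, exactly when at most
  \<open>n\<close> of the sets \<open>h i\<close> contain
  \<open>minimal_below A r a\<close>.\<close>

definition leg_weight ::
    "'a set \<Rightarrow> 'a rel \<Rightarrow> nat \<Rightarrow> (nat \<Rightarrow> 'a set) \<Rightarrow> 'a \<Rightarrow> wstar \<Rightarrow> real" where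
  "leg_weight A r n h a s = (case s of
      Wz \<Rightarrow> 1 - real (card {i. i \<le> n \<and> minimal_below A r a \<subseteq> h i}) / real n
    | Wy i \<Rightarrow> if i \<le> n \<and> minimal_below A r a \<subseteq> h i then 1 / real n else 0
    | Wystar \<Rightarrow> 0)"

definition leg_system ::
    "'a set \<Rightarrow> 'a rel \<Rightarrow> nat \<Rightarrow> (nat \<Rightarrow> 'a set) \<Rightarrow> 'a \<Rightarrow> wstar measure" where
  "leg_system A r n h a = point_measure (wstar_carrier n) (\<lambda>s. ennreal (leg_weight A r n h a s))"

lemma finite_wstar_carrier: "finite (wstar_carrier n)"
  by (simp add: wstar_carrier_def wstar_legs_def)

lemma sum_leg_weight: "(\<Sum>s\<in>wstar_carrier n. leg_weight A r n h a s) = 1"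
proof -
  let ?I = "{i. i \<le> n \<and> minimal_below A r a \<subseteq> h i}"
  have "(\<Sum>s\<in>Wy ` {0..n}. leg_weight A r n h a s) = (\<Sum>i\<in>{0..n}. leg_weight A r n h a (Wy i))"
    by (subst sum.reindex) (auto simp: inj_on_def)
  also have "\<dots> = (\<Sum>i\<in>?I. 1 / real n)"
    by (rule sum.mono_neutral_cong_right) (auto simp: leg_weight_def)
  finally have "(\<Sum>s\<in>Wy ` {0..n}. leg_weight A r n h a s) = real (card ?I) / real n" by simp
  moreover have "Wystar \<notin> Wy ` {0..n}" "Wz \<notin> insert Wystar (Wy ` {0..n})" by auto
  ultimately show ?thesis
    by (simp add: wstar_carrier_def wstar_legs_def) (simp add: leg_weight_def)
qed

lemma not_helly_fails:
  assumes A: "finite A" "partial_order_on A r" and "\<not> helly (linked_sets A r)"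
  shows "\<exists>n\<ge>1. monotonicity_equivalence_fails A r (wstar_carrier n) (wstar_order n)"
proof -
  let ?B = "minimal_below A r"
  obtain F where F: "F \<subseteq> linked_sets A r" "F \<noteq> {}" "\<Inter>F = {}"
    and meet: "\<And>X Y. X \<in> F \<Longrightarrow> Y \<in> F \<Longrightarrow> X \<inter> Y \<noteq> {}"
    using assms(3) unfolding helly_def by blast
  have "linked_sets A r \<subseteq> Pow A" by (auto simp: linked_sets_def minimal_elements_def)
  then have finF: "finite F" using F(1) A(1) finite_subset by (metis finite_Pow_iff)
  \<comment> \<open>The members of \<open>F\<close> are indexed by \<open>0..n\<close>. A single
    member would be nonempty and equal to its own intersection, so there are at least two and
    \<open>n \<ge> 1\<close>.\<close>
  define n where "n = card F - 1"
  have "card F \<noteq> 1"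
  proof
    assume "card F = 1"
    then obtain X where "F = {X}" by (auto simp: card_1_singleton_iff)
    then show False using F(3) meet[of X X] by simp
  qed
  moreover have "card F \<noteq> 0" using F(2) finF by simp
  ultimately have n: "n \<ge> 1" and cF: "card F = card {0..n}" by (auto simp: n_def)
  obtain h where h: "bij_betw h {0..n} F"
    using finite_same_card_bij[OF _ finF, of "{0..n}"] cF by auto
  have hF: "h i \<in> F" if "i \<le> n" for i using h that by (auto simp: bij_betw_def)
  have hL: "h i \<in> linked_sets A r" if "i \<le> n" for i using hF[OF that] F(1) by blast
  define wt where "wt = leg_weight A r n h"
  define P where "P = leg_system A r n h"
  have wt0: "0 \<le> wt a s" if a: "a \<in> A" for a s
  proof (cases s)
    case Wz
    let ?I = "{i. i \<le> n \<and> ?B a \<subseteq> h i}"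
    \<comment> \<open>Some \<open>h j\<close> omits \<open>b\<close> because the total intersection
      is empty; hence at most \<open>n\<close> legs receive mass.\<close>
    obtain b where b: "b \<in> ?B a" using minimal_below_nonempty[OF A a] by blast
    obtain X where "X \<in> F" "b \<notin> X" using F(3) by blast
    then obtain j where "j \<le> n" "b \<notin> h j" using h by (auto simp: bij_betw_def)
    then have "?I \<subseteq> {0..n} - {j}" using b by auto
    then have "card ?I \<le> n" using card_mono[of "{0..n} - {j}" ?I] \<open>j \<le> n\<close> by simp
    then show ?thesis using n by (simp add: wt_def leg_weight_def Wz)
  qed (auto simp: wt_def leg_weight_def)
  have mP: "measure (P a) U = sum (wt a) U" if "a \<in> A" "U \<subseteq> wstar_carrier n" for a U
    unfolding P_def leg_system_def wt_def[symmetric]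
    using wt0 that by (subst measure_point_measure_finite_if) (auto simp: finite_wstar_carrier)
  have sum1: "sum (wt a) (wstar_carrier n) = 1" for a
    unfolding wt_def by (rule sum_leg_weight)
  have "prob_system A (wstar_carrier n) P"
    unfolding prob_system_def P_def leg_system_def wt_def[symmetric]
    using wt0 sum1
    by (auto intro!: prob_space_point_measure simp: finite_wstar_carrier sets_point_measure sum_ennreal)
  moreover have "stochastically_monotone A r (wstar_carrier n) (wstar_order n) P"
    unfolding stochastically_monotone_def stoch_le_def
  proof (intro ballI impI allI)
    fix a b U assume a: "a \<in> A" and b: "b \<in> A" and "(a, b) \<in> r - Id"
      and U: "up_set (wstar_carrier n) (wstar_order n) U"
    then have "?B a \<subseteq> ?B b" using minimal_below_mono[OF A(2)] by blast
    \<comment> \<open>Going up in \<open>A\<close> enlarges \<open>?B\<close>, so fewer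
      \<open>h i\<close> contain it and mass moves from legs to \<open>Wz\<close>. A nonempty up-set
      contains \<open>Wz\<close>, so the comparison is made on its complement.\<close>
    then have anti: "wt b s \<le> wt a s" if "s \<noteq> Wz" for s
      using that by (cases s) (auto simp: wt_def leg_weight_def)
    have Uc: "U \<subseteq> wstar_carrier n" using U by (simp add: up_set_def)
    show "measure (P a) U \<le> measure (P b) U"
    proof (cases "U = {}")
      case False
      then obtain x where x: "x \<in> U" "x \<in> wstar_carrier n" using Uc by blast
      then have "(x, Wz) \<in> wstar_order n" by (auto simp: wstar_order_def wstar_carrier_def)
      then have "Wz \<in> U" using U x by (auto simp: up_set_def wstar_carrier_def)
      then have "sum (wt b) (wstar_carrier n - U) \<le> sum (wt a) (wstar_carrier n - U)"
        by (intro sum_mono anti) auto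
      then show ?thesis
        using sum1 sum_diff[OF finite_wstar_carrier Uc, where f = "wt a"]
          sum_diff[OF finite_wstar_carrier Uc, where f = "wt b"] mP a b Uc by simp
    qed simp
  qed
  moreover have "\<not> realizably_monotone A r (wstar_carrier n) (wstar_order n) P"
  proof
    assume "realizably_monotone A r (wstar_carrier n) (wstar_order n) P"
    then obtain M :: "('a \<Rightarrow> wstar) measure" and X
      where R: "realized_by A r (wstar_carrier n) (wstar_order n) P M X"
      unfolding realizably_monotone_def by blast
    interpret prob_space M using R by (simp add: realized_by_def)
    have Wy: "Wy i \<in> wstar_carrier n" if "i \<le> n" for i
      using that by (simp add: wstar_carrier_def wstar_legs_def)
    have leg: "measure (P a) {Wy i} = 1 / real n" if "a \<in> A" "i \<le> n" "?B a \<subseteq> h i" for a i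
      using mP[OF that(1), of "{Wy i}"] Wy that by (simp add: wt_def leg_weight_def)
    have minA: "b \<in> A" if "b \<in> minimal_elements A r" for b
      using that by (simp add: minimal_elements_def)
    have legmin: "measure (P b) {Wy i} = 1 / real n" and hA: "b \<in> A" if "i \<le> n" "b \<in> h i" for b i
    proof -
      have b: "b \<in> minimal_elements A r" using hL that by (auto simp: linked_sets_def)
      show "b \<in> A" using minA[OF b] .
      then show "measure (P b) {Wy i} = 1 / real n"
        using leg[of b i] minimal_below_minimal[OF A(2) b] that by simp
    qed
    have agree: "AE w in M. X a w = Wy i \<longleftrightarrow> X b w = Wy i"
      if "a \<in> A" "i \<le> n" "?B a \<subseteq> h i" "b \<in> ?B a" for a b i
    proof (rule realized_legs_agree[OF R])
      have "b \<in> h i" using that by blast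
      then show "b \<in> A" "measure (P a) {Wy i} = measure (P b) {Wy i}"
        using hA legmin leg that by auto
      show "(b, a) \<in> r" using that(4) by (simp add: minimal_below_def)
    qed (use that in auto)
    \<comment> \<open>Each link in \<open>h i\<close> runs through some \<open>a\<close> with
      \<open>?B a \<subseteq> h i\<close>, where leg \<open>i\<close> has the same mass
      \<open>1 / n\<close> as at the minimal elements, so agreement propagates along the
      walk.\<close>
    have same: "AE w in M. X b w = Wy i \<longleftrightarrow> X b' w = Wy i" if "i \<le> n" "b \<in> h i" "b' \<in> h i" for b b' i
    proof -
      have "(b, b') \<in> (adj (below_edges A r (h i)))\<^sup>*"
        using hL that by (auto simp: linked_sets_def graph_connected_def)
      then show ?thesis
      proof induction
        case (step y z)
        obtain a where a: "a \<in> A" "?B a \<subseteq> h i" "y \<in> ?B a" "z \<in> ?B a"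
          by (rule below_edgesE[OF step.hyps(2)])
        show ?case
          using step.IH agree[OF a(1) that(1) a(2,3)] agree[OF a(1) that(1) a(2,4)] by eventually_elim simp
      qed simp
    qed
    define c where "c i = (SOME b. b \<in> h i)" for i
    have c: "c i \<in> h i" if "i \<le> n" for i
      using meet[OF hF[OF that] hF[OF that]] by (auto simp: c_def some_in_eq)
    define E where "E i = {w \<in> space M. X (c i) w = Wy i}" for i
    have E: "prob (E i) = 1 / real n" "E i \<in> sets M" if "i \<le> n" for i
      unfolding E_def using realized_by_measure[OF R hA[OF that c[OF that]] Wy[OF that]]
        legmin[OF that c[OF that]] by auto
    have "pairwise (\<lambda>i j. AE w in M. w \<notin> E i \<or> w \<notin> E j) {0..n}"
      unfolding pairwise_def
    proof (intro ballI impI)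
      fix i j assume "i \<in> {0..n}" "j \<in> {0..n}" and ij: "i \<noteq> j"
      then have le: "i \<le> n" "j \<le> n" by auto
      \<comment> \<open>At a common point \<open>b\<close>, the events \<open>E i\<close> and
        \<open>E j\<close> would require \<open>X b\<close> to take two different values.\<close>
      obtain b where b: "b \<in> h i" "b \<in> h j" using meet hF le by blast
      show "AE w in M. w \<notin> E i \<or> w \<notin> E j"
        using same[OF le(1) c[OF le(1)] b(1)] same[OF le(2) c[OF le(2)] b(2)]
        by eventually_elim (use ij in \<open>auto simp: E_def\<close>)
    qed
    then have "prob (\<Union>i\<in>{0..n}. E i) = (\<Sum>i\<in>{0..n}. prob (E i))"
      using E(2) by (intro measure_UNION_AE) (auto simp: fmeasurable_eq_sets)
    also have "\<dots> = real (n + 1) / real n" using E(1) by simp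
    also have "\<dots> > 1" using n by simp
    finally show False using prob_le_1[of "\<Union>i\<in>{0..n}. E i"] by simp
  qed
  ultimately have "monotonicity_equivalence_fails A r (wstar_carrier n) (wstar_order n)"
    unfolding monotonicity_equivalence_fails_def by blast
  then show ?thesis using n by blast
qed

theorem proposition4p1:
  fixes A :: "'a set" and r :: "'a rel"
  assumes "finite A" and "partial_order_on A r"
    and "graph_connected A (hasse_edges A r)"
    and "\<not> synchronizable A r"
  shows "\<exists>n\<ge>1. monotonicity_equivalence_fails A r (wstar_carrier n) (wstar_order n)"
  using not_helly_fails[OF assms(1,2)] helly_synchronizable[OF assms(1-3)] assms(4) by blast

end
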